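(* Let $T:V\to\mathfrak g$ be a relative Rota-Baxter operator on an $n$-LieRep pair $(\mathfrak g,[-,\cdots,-]_{\mathfrak g};\rho)$. There is a one-to-one correspondence between the space of equivalence classes of infinitesimal deformations of the relative Rota-Baxter operator $T$ and the first cohomology group $\mathcal H^1(V,\mathfrak g)$ of $T$.
   Context: All vector spaces are finite dimensional over an algebraically closed field $\mathbb K$ of characteristic $0$; $n\ge2$; a hat denotes omission. An $n$-Lie algebra is a vector space $\mathfrak g$ with a skew-symmetric linear map $[-,\cdots,-]_{\mathfrak g}:\wedge^n\mathfrak g\to\mathfrak g$ such that $[x_1,\cdots,x_{n-1},[y_1,\cdots,y_n]]=\sum_{i=1}^n[y_1,\cdots,y_{i-1},[x_1,\cdots,x_{n-1},y_i],y_{i+1},\cdots,y_n]$. For $\mathfrak X=x_1\wedge\cdots\wedge x_{n-1}$ write $\mathrm{ad}_{\mathfrak X}y=[\mathfrak X,y]_{\mathfrak g}=[x_1,\cdots,x_{n-1},y]_{\mathfrak g}$, extended linearly to $\mathfrak X\in\wedge^{n-1}\mathfrak g$. A representation of $\mathfrak g$ on $V$ is a linear map $\rho:\wedge^{n-1}\mathfrak g\to\mathfrak{gl}(V)$ with $[\rho(\mathfrak X),\rho(\mathfrak Y)]=\rho(\mathfrak X\circ\mathfrak Y)$ (commutator), where for $\mathfrak Y=y_1\wedge\cdots\wedge y_{n-1}$, $\mathfrak X\circ\mathfrak Y=\sum_{i=1}^{n-1}y_1\wedge\cdots\wedge[\mathfrak X,y_i]_{\mathfrak g}\wedge\cdots\wedge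 y_{n-1}$, and $\rho(x_1,\cdots,x_{n-2},[y_1,\cdots,y_n]_{\mathfrak g})=\sum_{i=1}^n(-1)^{n-i}\rho(y_1,\cdots,\widehat{y_i},\cdots,y_n)\rho(x_1,\cdots,x_{n-2},y_i)$. An $n$-LieRep pair is an $n$-Lie algebra with a representation $\rho$ on a vector space $V$. A relative Rota-Baxter operator on it is a linear map $T:V\to\mathfrak g$ with $[Tv_1,\cdots,Tv_n]_{\mathfrak g}=\sum_{i=1}^n(-1)^{n-i}T(\rho(Tv_1,\cdots,\widehat{Tv_i},\cdots,Tv_n)(v_i))$. Cohomology of $T$ in degree $1$: $V$ is an $n$-Lie algebra under $[u_1,\cdots,u_n]_T=\sum_{i=1}^n(-1)^{n-i}\rho(Tu_1,\cdots,\widehat{Tu_i},\cdots,Tu_n)(u_i)$, and $\rho_T:\wedge^{n-1}V\to\mathfrak{gl}(\mathfrak g)$, $\rho_T(u_1,\cdots,u_{n-1})x=[Tu_1,\cdots,Tu_{n-1},x]_{\mathfrak g}-\sum_{i=1}^{n-1}(-1)^{n-i}T\rho(Tu_1,\cdots,\widehat{Tu_i},\cdots,Tu_{n-1},x)(u_i)$ is a representation of it on $\mathfrak g$. The cochain complex begins with $C_T^0(V;\mathfrak g)=\wedge^{n-1}\mathfrak g$, $C_T^1(V;\mathfrak g)=\mathrm{Hom}(V,\mathfrak g)$, $C_T^2(V;\mathfrak g)=\mathrm{Hom}(\wedge^nV,\mathfrak g)$. The differential $d:C^0_T\to C^1_T$ is $(d\mathfrak X)(v)=T\rho(\mathfrak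 X)v-[\mathfrak X,Tv]_{\mathfrak g}$, and $d:C^1_T\to C^2_T$ is, for $\mathfrak U=u^1\wedge\cdots\wedge u^{n-1}$, $$(df)(\mathfrak U,v)=-f([u^1,\cdots,u^{n-1},v]_T)+\rho_T(\mathfrak U)f(v)+\sum_{i=1}^{n-1}(-1)^{n-i}\rho_T(u^1,\cdots,\widehat{u^i},\cdots,u^{n-1},v)f(u^i).$$ $\mathcal H^1(V,\mathfrak g)=\ker(d|_{C^1_T})/d(C^0_T)$. An infinitesimal deformation of $T$, denoted $(\mathfrak g,\mathfrak T_1)$, is a linear map $\mathfrak T_1:V\to\mathfrak g$ such that $T_t=T+t\mathfrak T_1$ satisfies $[T_tu_1,\cdots,T_tu_n]_{\mathfrak g}=T_t\big(\sum_{i=1}^n(-1)^{n-i}\rho(T_tu_1,\cdots,\widehat{T_tu_i},\cdots,T_tu_n)(u_i)\big)$ modulo $t^2$ (all structure maps extended $\mathbb K[t]/(t^2)$-multilinearly) for all $u_i\in V$. Two infinitesimal deformations $(\mathfrak g,\mathfrak T_1)$ and $(\mathfrak g,\mathfrak T_1')$ are equivalent if there exists $\mathfrak X\in\wedge^{n-1}\mathfrak g$ such that for $\phi_t=\mathrm{Id}_{\mathfrak g}+t\,\mathrm{ad}_{\mathfrak X}$ and $\varphi_t=\mathrm{Id}_V+t\rho(\mathfrak X)$, modulo $t^2$: (i) $[\phi_t(x_1),\cdots,\phi_t(x_n)]_{\mathfrak g}=\phi_t[x_1,\cdots,x_n]_{\mathfrak g}$; (ii) $\varphi_t\rho(x_1,\cdots,x_{n-1})(u)=\rho(\phi_t(x_1),\cdots,\phi_t(x_{n-1}))(\varphi_t(u))$;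 (iii) $T_t\circ\varphi_t=\phi_t\circ T_t'$, where $T_t=T+t\mathfrak T_1$, $T_t'=T+t\mathfrak T_1'$. *)

theory Defs
  imports
    "HOL-Computational_Algebra.Polynomial"
    "HOL-Library.Poly_Mapping"
    "HOL-Library.Product_Plus"
begin

section \<open>Lists of arguments and signs\<close>

definition omit :: "nat \<Rightarrow> 'a list \<Rightarrow> 'a list" where
  "omit i xs = take i xs @ drop (Suc i) xs"

text \<open>Multiplication by \<open>(-1)^k\<close>.  List positions start at 0, so the sign \<open>(-1)^(n-i)\<close>
  attached to the \<open>i\<close>-th of \<open>n\<close> arguments (\<open>1 \<le> i \<le> n\<close>) becomes
  \<open>psign (n - 1 - i)\<close> for \<open>i < n\<close>.\<close>

definition psign :: "nat \<Rightarrow> 'a \<Rightarrow> 'a::ab_group_add" where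
  "psign k x = (if even k then x else - x)"

section \<open>Skew-symmetric maps and exterior powers\<close>

text \<open>A linear map out of the \<open>k\<close>-th exterior power is given by its values on decomposable
  elements, i.e. by an alternating \<open>k\<close>-linear map, written as a function on lists of which
  only the values on lists of length \<open>k\<close> matter.\<close>

definition alternating_multilinear ::
  "nat \<Rightarrow> ('k::field \<Rightarrow> 'a::ab_group_add \<Rightarrow> 'a) \<Rightarrow> ('k \<Rightarrow> 'b::ab_group_add \<Rightarrow> 'b) \<Rightarrow> ('a list \<Rightarrow> 'b) \<Rightarrow> bool"
where
  "alternating_multilinear k s s' f \<longleftrightarrow>
     (\<forall>xs i x y. length xs = k \<longrightarrow> i < k \<longrightarrow> f (xs[i := x + y]) = f (xs[i := x]) + f (xs[i := y])) \<and>
     (\<forall>xs i c x. length xs = k \<longrightarrow> i < k \<longrightarrow> f (xs[i := s c x]) = s' c (f (xs[i := x]))) \<and>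
     (\<forall>xs i j. length xs = k \<longrightarrow> i < j \<longrightarrow> j < k \<longrightarrow> xs ! i = xs ! j \<longrightarrow> f xs = 0)"

text \<open>The \<open>k\<close>-th exterior power is the vector space with basis all lists of length \<open>k\<close>, modulo
  the span of the relations of multilinearity and alternation; its elements are cosets.\<close>

definition free_scale :: "'k::field \<Rightarrow> ('x \<Rightarrow>\<^sub>0 'k) \<Rightarrow> ('x \<Rightarrow>\<^sub>0 'k)" where
  "free_scale c p = Poly_Mapping.map ((*) c) p"

definition ext_relators ::
  "nat \<Rightarrow> ('k::field \<Rightarrow> 'a::ab_group_add \<Rightarrow> 'a) \<Rightarrow> ('a list \<Rightarrow>\<^sub>0 'k) set" where
  "ext_relators k s =
     {Poly_Mapping.single (xs[i := x + y]) 1 - Poly_Mapping.single (xs[i := x]) 1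
        - Poly_Mapping.single (xs[i := y]) 1 | xs i x y. length xs = k \<and> i < k} \<union>
     {Poly_Mapping.single (xs[i := s c x]) 1 - Poly_Mapping.single (xs[i := x]) c
        | xs i c x. length xs = k \<and> i < k} \<union>
     {Poly_Mapping.single xs 1 | xs i j. length xs = k \<and> i < j \<and> j < k \<and> xs ! i = xs ! j}"

definition ext_class ::
  "nat \<Rightarrow> ('k::field \<Rightarrow> 'a::ab_group_add \<Rightarrow> 'a) \<Rightarrow> ('a list \<Rightarrow>\<^sub>0 'k) \<Rightarrow> ('a list \<Rightarrow>\<^sub>0 'k) set" where
  "ext_class k s p = {q. q - p \<in> module.span free_scale (ext_relators k s)}"

definition ext_power ::
  "nat \<Rightarrow> ('k::field \<Rightarrow> 'a::ab_group_add \<Rightarrow> 'a) \<Rightarrow> ('a list \<Rightarrow>\<^sub>0 'k) set set" where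
  "ext_power k s = ext_class k s ` {p. \<forall>xs\<in>Poly_Mapping.keys p. length xs = k}"

definition wedge ::
  "('k::field \<Rightarrow> 'a::ab_group_add \<Rightarrow> 'a) \<Rightarrow> 'a list \<Rightarrow> ('a list \<Rightarrow>\<^sub>0 'k) set" where
  "wedge s xs = ext_class (length xs) s (Poly_Mapping.single xs 1)"

definition free_ext :: "('k::field \<Rightarrow> 'b::ab_group_add \<Rightarrow> 'b) \<Rightarrow> ('x \<Rightarrow> 'b) \<Rightarrow> ('x \<Rightarrow>\<^sub>0 'k) \<Rightarrow> 'b" where
  "free_ext s f p = (\<Sum>x\<in>Poly_Mapping.keys p. s (Poly_Mapping.lookup p x) (f x))"

text \<open>The linear map on the exterior power induced by \<open>f\<close>: the common value of \<open>free_ext s f\<close>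
  on the representatives of the coset.\<close>

definition ext_lift ::
  "('k::field \<Rightarrow> 'b::ab_group_add \<Rightarrow> 'b) \<Rightarrow> ('x \<Rightarrow> 'b) \<Rightarrow> ('x \<Rightarrow>\<^sub>0 'k) set \<Rightarrow> 'b" where
  "ext_lift s f X = the_elem (free_ext s f ` X)"

lemma lookup_free_scale [simp]: "Poly_Mapping.lookup (free_scale c p) x = c * Poly_Mapping.lookup p x"
  by (simp add: free_scale_def Poly_Mapping.map.rep_eq when_def)

lemma vector_space_free_scale: "vector_space free_scale"
  by unfold_locales (auto intro!: poly_mapping_eqI simp: lookup_add algebra_simps)

context vector_space
begin

lemma free_ext_superset:
  assumes "finite A" "Poly_Mapping.keys p \<subseteq> A"
  shows "free_ext scale f p = (\<Sum>x\<in>A. scale (Poly_Mapping.lookup p x) (f x))"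
  unfolding free_ext_def using assms
  by (intro sum.mono_neutral_left) (auto simp: in_keys_iff)

lemma free_ext_single [simp]: "free_ext scale f (Poly_Mapping.single x c) = scale c (f x)"
  by (subst free_ext_superset[of "{x}"]) auto

lemma free_ext_linear:
  fixes f :: "'x \<Rightarrow> 'b"
  shows "Vector_Spaces.linear free_scale scale (free_ext scale f)"
proof -
  interpret F: vector_space free_scale by (rule vector_space_free_scale)
  show ?thesis
  proof unfold_locales
    fix p q :: "'x \<Rightarrow>\<^sub>0 'a"
    let ?A = "Poly_Mapping.keys p \<union> Poly_Mapping.keys q"
    have "free_ext scale f (p + q) = (\<Sum>x\<in>?A. scale (Poly_Mapping.lookup (p + q) x) (f x))"
      by (rule free_ext_superset) (use keys_add[of p q] in auto)
    moreover have "free_ext scale f p = (\<Sum>x\<in>?A. scale (Poly_Mapping.lookup p x) (f x))"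
      "free_ext scale f q = (\<Sum>x\<in>?A. scale (Poly_Mapping.lookup q x) (f x))"
      by (rule free_ext_superset; auto)+
    ultimately show "free_ext scale f (p + q) = free_ext scale f p + free_ext scale f q"
      by (simp add: lookup_add scale_left_distrib sum.distrib)
  next
    fix c and p :: "'x \<Rightarrow>\<^sub>0 'a"
    have "free_ext scale f (free_scale c p) =
        (\<Sum>x\<in>Poly_Mapping.keys p. scale (Poly_Mapping.lookup (free_scale c p) x) (f x))"
      by (rule free_ext_superset) (auto simp: in_keys_iff)
    then show "free_ext scale f (free_scale c p) = scale c (free_ext scale f p)"
      by (simp add: free_ext_def scale_sum_right)
  qed
qed

lemma ext_lift_ext_class:
  assumes f: "alternating_multilinear k s scale f"
  shows "ext_lift scale f (ext_class k s p) = free_ext scale f p"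
proof -
  interpret F: vector_space free_scale by (rule vector_space_free_scale)
  interpret L: Vector_Spaces.linear free_scale scale "free_ext scale f" by (rule free_ext_linear)
  have rel: "free_ext scale f r = 0" if "r \<in> ext_relators k s" for r
    using that f unfolding ext_relators_def alternating_multilinear_def
    by (auto simp: L.diff)
  have zero: "free_ext scale f r = 0" if "r \<in> F.span (ext_relators k s)" for r
    using rel that by (rule L.eq_0_on_span)
  have "free_ext scale f q = free_ext scale f p" if "q \<in> ext_class k s p" for q
    using zero[of "q - p"] that by (simp add: ext_class_def L.diff)
  moreover have "p \<in> ext_class k s p"
    by (simp add: ext_class_def F.span_zero)
  ultimately have "free_ext scale f ` ext_class k s p = {free_ext scale f p}"
    by blast
  then show ?thesis by (simp add: ext_lift_def)
qed

lemma ext_lift_wedge: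
  assumes "alternating_multilinear (length xs) s scale f"
  shows "ext_lift scale f (wedge s xs) = f xs"
  using ext_lift_ext_class[OF assms] by (simp add: wedge_def)

end

section \<open>Extension of scalars to \<open>K[t]/(t^2)\<close>\<close>

text \<open>An element \<open>a + t b\<close> of \<open>M[t]/(t^2)\<close> is the pair \<open>(a, b)\<close>, with componentwise addition.  An
  element \<open>A + t B\<close> of \<open>Hom(M, N)[t]/(t^2)\<close> is likewise a pair of maps, and acts by
  \<open>(A + t B) (u + t w) = A u + t (B u + A w)\<close>.\<close>

definition dconst :: "'a \<Rightarrow> 'a \<times> 'a::zero" where
  "dconst x = (x, 0)"

definition dscale :: "('k::field \<Rightarrow> 'a::ab_group_add \<Rightarrow> 'a) \<Rightarrow> 'k \<times> 'k \<Rightarrow> 'a \<times> 'a \<Rightarrow> 'a \<times> 'a" where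
  "dscale s c p = (s (fst c) (fst p), s (fst c) (snd p) + s (snd c) (fst p))"

definition dapply :: "('a \<Rightarrow> 'b) \<Rightarrow> ('a \<Rightarrow> 'b::ab_group_add) \<Rightarrow> 'a \<times> 'a \<Rightarrow> 'b \<times> 'b" where
  "dapply A B p = (A (fst p), B (fst p) + A (snd p))"

text \<open>The multilinear extension: \<open>f (a\<^sub>1 + t b\<^sub>1, \<dots>, a\<^sub>k + t b\<^sub>k)\<close> has constant term
  \<open>f (a\<^sub>1, \<dots>, a\<^sub>k)\<close> and \<open>t\<close>-coefficient \<open>\<Sum>\<^sub>i f (a\<^sub>1, \<dots>, b\<^sub>i, \<dots>, a\<^sub>k)\<close>.\<close>

definition dmulti_t :: "('a list \<Rightarrow> 'b::ab_group_add) \<Rightarrow> ('a \<times> 'a) list \<Rightarrow> 'b" where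
  "dmulti_t f ps = (\<Sum>i<length ps. f ((map fst ps)[i := snd (ps ! i)]))"

definition dmulti :: "('a list \<Rightarrow> 'b::ab_group_add) \<Rightarrow> ('a \<times> 'a) list \<Rightarrow> 'b \<times> 'b" where
  "dmulti f ps = (f (map fst ps), dmulti_t f ps)"

definition dmulti_act ::
  "('a list \<Rightarrow> 'b \<Rightarrow> 'b::ab_group_add) \<Rightarrow> ('a \<times> 'a) list \<Rightarrow> 'b \<times> 'b \<Rightarrow> 'b \<times> 'b" where
  "dmulti_act r ps = dapply (r (map fst ps)) (\<lambda>v. dmulti_t (\<lambda>xs. r xs v) ps)"

lemma dmulti_t_update:
  assumes "i < length ps"
  shows "dmulti_t f (ps[i := p]) = f ((map fst ps)[i := snd p]) +
    (\<Sum>j\<in>{..<length ps} - {i}. f (((map fst ps)[j := snd (ps ! j)])[i := fst p]))"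
proof -
  have "dmulti_t f (ps[i := p]) = f ((map fst ps)[i := snd p]) +
    (\<Sum>j\<in>{..<length ps} - {i}. f ((map fst (ps[i := p]))[j := snd ((ps[i := p]) ! j)]))"
    unfolding dmulti_t_def using assms
    by (subst sum.remove[of _ i]) (auto simp: map_update)
  also have "(\<Sum>j\<in>{..<length ps} - {i}. f ((map fst (ps[i := p]))[j := snd ((ps[i := p]) ! j)])) =
    (\<Sum>j\<in>{..<length ps} - {i}. f (((map fst ps)[j := snd (ps ! j)])[i := fst p]))"
    by (intro sum.cong) (auto simp: map_update list_update_swap)
  finally show ?thesis .
qed

lemma dmulti_add:
  assumes "alternating_multilinear k s s' f" "length ps = k" "i < k"
  shows "dmulti f (ps[i := p + q]) = dmulti f (ps[i := p]) + dmulti f (ps[i := q])"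
  using assms by (simp add: dmulti_def dmulti_t_update map_update alternating_multilinear_def
      sum.distrib algebra_simps)

lemma dmulti_dscale:
  assumes "vector_space s'" "alternating_multilinear k s s' f" "length ps = k" "i < k"
  shows "dmulti f (ps[i := dscale s c p]) = dscale s' c (dmulti f (ps[i := p]))"
proof -
  interpret vector_space s' by fact
  show ?thesis
    using assms(2-) by (simp add: dmulti_def dmulti_t_update map_update
        alternating_multilinear_def dscale_def scale_right_distrib scale_sum_right algebra_simps)
qed

lemma dmulti_dconst:
  assumes "vector_space s" "vector_space s'" "alternating_multilinear k s s' f" "length xs = k"
  shows "dmulti f (map dconst xs) = dconst (f xs)"
proof -
  interpret s: vector_space s by fact
  interpret s': vector_space s' by fact
  have "f (xs[i := s 0 0]) = s' 0 (f (xs[i := 0]))" if "i < k" for i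
    using assms(3,4) that unfolding alternating_multilinear_def by blast
  then show ?thesis
    using assms(4) by (simp add: dmulti_def dmulti_t_def dconst_def comp_def)
qed

section \<open>\<open>n\<close>-Lie algebras and representations\<close>

locale n_lie_algebra =
  fixes n :: nat
    and sg :: "'k::{alg_closed_field, field_char_0} \<Rightarrow> 'g::ab_group_add \<Rightarrow> 'g"
    and br :: "'g list \<Rightarrow> 'g"
  assumes n_ge_2: "n \<ge> 2"
    and fin_dim_g: "\<exists>B. finite_dimensional_vector_space sg B"
    and br_alternating: "alternating_multilinear n sg sg br"
    and fundamental_identity:
      "\<And>xs ys. length xs = n - 1 \<Longrightarrow> length ys = n \<Longrightarrow>
         br (xs @ [br ys]) = (\<Sum>i<n. br (ys[i := br (xs @ [ys ! i])]))"
begin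

definition ad :: "('g list \<Rightarrow>\<^sub>0 'k) set \<Rightarrow> 'g \<Rightarrow> 'g" where
  "ad X y = ext_lift sg (\<lambda>xs. br (xs @ [y])) X"

end

locale n_lie_rep_pair = n_lie_algebra n sg br
  for n :: nat
    and sg :: "'k::{alg_closed_field, field_char_0} \<Rightarrow> 'g::ab_group_add \<Rightarrow> 'g"
    and br :: "'g list \<Rightarrow> 'g" +
  fixes sv :: "'k \<Rightarrow> 'v::ab_group_add \<Rightarrow> 'v"
    and rho :: "'g list \<Rightarrow> 'v \<Rightarrow> 'v"
  assumes fin_dim_v: "\<exists>B. finite_dimensional_vector_space sv B"
    and rho_linear: "\<And>xs. length xs = n - 1 \<Longrightarrow> Vector_Spaces.linear sv sv (rho xs)"
    and rho_alternating: "\<And>v. alternating_multilinear (n - 1) sg sv (\<lambda>xs. rho xs v)"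
    and rho_commutator:
      "\<And>xs ys v. length xs = n - 1 \<Longrightarrow> length ys = n - 1 \<Longrightarrow>
         rho xs (rho ys v) - rho ys (rho xs v) =
           (\<Sum>i<n - 1. rho (ys[i := br (xs @ [ys ! i])]) v)"
    and rho_bracket:
      "\<And>xs ys v. length xs = n - 2 \<Longrightarrow> length ys = n \<Longrightarrow>
         rho (xs @ [br ys]) v =
           (\<Sum>i<n. psign (n - 1 - i) (rho (omit i ys) (rho (xs @ [ys ! i]) v)))"
begin

definition rho_ext :: "('g list \<Rightarrow>\<^sub>0 'k) set \<Rightarrow> 'v \<Rightarrow> 'v" where
  "rho_ext X v = ext_lift sv (\<lambda>xs. rho xs v) X"

end

section \<open>Relative Rota-Baxter operators, cohomology and deformations\<close>

locale relative_rota_baxter = n_lie_rep_pair n sg br sv rho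
  for n :: nat
    and sg :: "'k::{alg_closed_field, field_char_0} \<Rightarrow> 'g::ab_group_add \<Rightarrow> 'g"
    and br :: "'g list \<Rightarrow> 'g"
    and sv :: "'k \<Rightarrow> 'v::ab_group_add \<Rightarrow> 'v"
    and rho :: "'g list \<Rightarrow> 'v \<Rightarrow> 'v" +
  fixes T :: "'v \<Rightarrow> 'g"
  assumes T_linear: "Vector_Spaces.linear sv sg T"
    and rota_baxter:
      "\<And>vs. length vs = n \<Longrightarrow>
         br (map T vs) = (\<Sum>i<n. psign (n - 1 - i) (T (rho (map T (omit i vs)) (vs ! i))))"
begin

definition br_T :: "'v list \<Rightarrow> 'v" where
  "br_T us = (\<Sum>i<n. psign (n - 1 - i) (rho (map T (omit i us)) (us ! i)))"

definition rho_T :: "'v list \<Rightarrow> 'g \<Rightarrow> 'g" where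
  "rho_T us x = br (map T us @ [x])
     - (\<Sum>i<n - 1. psign (n - 1 - i) (T (rho (map T (omit i us) @ [x]) (us ! i))))"

abbreviation C0 :: "('g list \<Rightarrow>\<^sub>0 'k) set set" where
  "C0 \<equiv> ext_power (n - 1) sg"

abbreviation C1 :: "('v \<Rightarrow> 'g) set" where
  "C1 \<equiv> {f. Vector_Spaces.linear sv sg f}"

definition d0 :: "('g list \<Rightarrow>\<^sub>0 'k) set \<Rightarrow> 'v \<Rightarrow> 'g" where
  "d0 X v = T (rho_ext X v) - ad X (T v)"

text \<open>\<open>d1 f us v\<close> is \<open>(df)(u\<^sup>1 \<and> \<dots> \<and> u\<^sup>n\<^sup>-\<^sup>1, v)\<close> for \<open>us\<close> of length \<open>n - 1\<close>.\<close>

definition d1 :: "('v \<Rightarrow> 'g) \<Rightarrow> 'v list \<Rightarrow> 'v \<Rightarrow> 'g" where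
  "d1 f us v = - f (br_T (us @ [v])) + rho_T us (f v)
     + (\<Sum>i<n - 1. psign (n - 1 - i) (rho_T (omit i us @ [v]) (f (us ! i))))"

definition Z1 :: "('v \<Rightarrow> 'g) set" where
  "Z1 = {f \<in> C1. \<forall>us v. length us = n - 1 \<longrightarrow> d1 f us v = 0}"

definition B1 :: "('v \<Rightarrow> 'g) set" where
  "B1 = d0 ` C0"

text \<open>The quotient of \<open>Z1\<close> by \<open>B1\<close> is the set of cosets \<open>f + B1\<close> with \<open>f \<in> Z1\<close>.\<close>

definition cohomology_class :: "('v \<Rightarrow> 'g) \<Rightarrow> ('v \<Rightarrow> 'g) set" where
  "cohomology_class f = {\<lambda>v. f v + b v | b. b \<in> B1}"

definition H1 :: "('v \<Rightarrow> 'g) set set" where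
  "H1 = cohomology_class ` Z1"

definition infinitesimal_deformations :: "('v \<Rightarrow> 'g) set" where
  "infinitesimal_deformations =
     {T1. Vector_Spaces.linear sv sg T1 \<and>
        (let Tt = dapply T T1 in
         \<forall>us. length us = n \<longrightarrow>
           dmulti br (map (\<lambda>u. Tt (dconst u)) us) =
           Tt (\<Sum>i<n. psign (n - 1 - i)
                 (dmulti_act rho (map (\<lambda>u. Tt (dconst u)) (omit i us)) (dconst (us ! i)))))}"

definition deformations_equivalent :: "('v \<Rightarrow> 'g) \<Rightarrow> ('v \<Rightarrow> 'g) \<Rightarrow> bool" where
  "deformations_equivalent T1 T1' \<longleftrightarrow>
     (\<exists>X \<in> ext_power (n - 1) sg.
        let phi = dapply id (ad X); psi = dapply id (rho_ext X) in
          (\<forall>xs. length xs = n \<longrightarrow>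
             dmulti br (map (\<lambda>x. phi (dconst x)) xs) = phi (dconst (br xs))) \<and>
          (\<forall>xs u. length xs = n - 1 \<longrightarrow>
             psi (dconst (rho xs u)) =
             dmulti_act rho (map (\<lambda>x. phi (dconst x)) xs) (psi (dconst u))) \<and>
          dapply T T1 \<circ> psi = phi \<circ> dapply T T1')"

definition deformation_rel :: "(('v \<Rightarrow> 'g) \<times> ('v \<Rightarrow> 'g)) set" where
  "deformation_rel =
     {(T1, T1'). T1 \<in> infinitesimal_deformations \<and> T1' \<in> infinitesimal_deformations \<and>
        deformations_equivalent T1 T1'}"

end

end

theory Submission
  imports Defs
begin

text \<open>The coefficient of \<open>t\<close> in the deformation equation for \<open>T + t f\<close> is, up to the order of
  summation in a double sum, the cocycle equation \<open>d f = 0\<close>.  In an equivalence of deformations,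
  conditions (i) and (ii) hold for every \<open>\<XX>\<close>, as \<open>ad\<^sub>\<XX>\<close> is a derivation of the bracket and
  \<open>\<rho>(\<XX>)\<close> is compatible with it; condition (iii) says that \<open>\<TT>\<^sub>1' - \<TT>\<^sub>1 = d \<XX>\<close>.\<close>

section \<open>Signs and omitted arguments\<close>

lemma psign_0 [simp]: "psign 0 x = x"
  by (simp add: psign_def)

lemma psign_psign: "psign j (psign k x) = psign (j + k) x"
  by (simp add: psign_def)

lemma psign_cong_even: "even j = even k \<Longrightarrow> psign j x = psign k x"
  by (simp add: psign_def)

lemma psign_diff: "psign k (x - y) = psign k x - psign k y"
  by (simp add: psign_def)

lemma psign_sum: "psign k (sum f A) = (\<Sum>i\<in>A. psign k (f i))"
  by (simp add: psign_def sum_negf)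

lemma fst_psign: "fst (psign k p) = psign k (fst p)"
  by (simp add: psign_def)

lemma snd_psign: "snd (psign k p) = psign k (snd p)"
  by (simp add: psign_def)

lemma linear_psign:
  assumes "Vector_Spaces.linear s s' f"
  shows "f (psign k x) = psign k (f x)"
proof -
  interpret Vector_Spaces.linear s s' f by fact
  show ?thesis by (simp add: psign_def neg)
qed

lemma length_omit [simp]: "i < length xs \<Longrightarrow> length (omit i xs) = length xs - 1"
  by (simp add: omit_def)

lemma map_omit: "map f (omit i xs) = omit i (map f xs)"
  by (simp add: omit_def take_map drop_map)

lemma nth_omit:
  "i < length xs \<Longrightarrow> j < length xs - 1 \<Longrightarrow> omit i xs ! j = (if j < i then xs ! j else xs ! Suc j)"
  by (auto simp: omit_def nth_append)

lemma omit_append_less: "i < length us \<Longrightarrow> omit i (us @ vs) = omit i us @ vs"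
  by (simp add: omit_def)

lemma omit_length_append [simp]: "omit (length us) (us @ [v]) = us"
  by (simp add: omit_def)

lemma omit_omit:
  assumes "j < i" "i < length xs"
  shows "omit j (omit i xs) = omit (i - 1) (omit j xs)"
  by (rule nth_equalityI) (use assms in \<open>auto simp: nth_omit\<close>)

text \<open>Both sides sum over ordered pairs of distinct positions; the reindexing exchanges the two
  members of the pair.\<close>

lemma sum_omit_omit_swap:
  fixes H :: "'a list \<Rightarrow> 'a \<Rightarrow> 'a \<Rightarrow> 'b::ab_group_add"
  assumes "length xs = n"
  shows "(\<Sum>i<n. \<Sum>j<n - 1. psign (n - 1 - i) (psign (n - 1 - j)
            (H (omit j (omit i xs)) (xs ! i) (omit i xs ! j)))) =
         (\<Sum>i<n. \<Sum>j<n - 1. psign (n - 1 - i) (psign (n - 2 - j)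
            (H (omit j (omit i xs)) (omit i xs ! j) (xs ! i))))"
proof -
  \<comment> \<open>A pair \<open>(i, j)\<close> records removing position \<open>i\<close> and then
    position \<open>j\<close> of the shortened list. The involution \<open>h\<close> names the same
    two positions removed in the opposite order.\<close>
  define h :: "nat \<times> nat \<Rightarrow> nat \<times> nat" where
    "h = (\<lambda>(i, j). if j < i then (j, i - 1) else (Suc j, i))"
  \<comment> \<open>If \<open>j < i\<close>, the second index drops to \<open>i - 1\<close>, which
    offsets the change from \<open>n - 1\<close> to \<open>n - 2\<close>. Otherwise the total
    exponent differs by 2.\<close>
  have par: "psign (n - 1 - fst (h (i, j))) (psign (n - 2 - snd (h (i, j))) x) =
      psign (n - 1 - i) (psign (n - 1 - j) x)" if "i < n" "j < n - 1" for i j and x :: 'b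
    unfolding psign_psign
  proof (rule psign_cong_even, cases "j < i")
    case True
    then have "n - 1 - fst (h (i, j)) + (n - 2 - snd (h (i, j))) = n - 1 - i + (n - 1 - j)"
      using that by (simp add: h_def)
    then show "even (n - 1 - fst (h (i, j)) + (n - 2 - snd (h (i, j)))) =
        even (n - 1 - i + (n - 1 - j))" by simp
  next
    case False
    then have "n - 1 - fst (h (i, j)) + (n - 2 - snd (h (i, j))) + 2 = n - 1 - i + (n - 1 - j)"
      using that by (simp add: h_def)
    moreover have "even a = even b" if "a + 2 = b" for a b :: nat
      using that by auto
    ultimately show "even (n - 1 - fst (h (i, j)) + (n - 2 - snd (h (i, j)))) =
        even (n - 1 - i + (n - 1 - j))" by blast
  qed
  show ?thesis
    unfolding sum.cartesian_product
  proof (rule sum.reindex_bij_witness[of _ h h], goal_cases)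
    case (5 p)
    obtain i j where p: "p = (i, j)" by force
    have ij: "i < n" "j < n - 1" using 5 p by auto
    have "omit (snd (h (i, j))) (omit (fst (h (i, j))) xs) = omit j (omit i xs)"
      "omit (fst (h (i, j))) xs ! snd (h (i, j)) = xs ! i"
      "xs ! fst (h (i, j)) = omit i xs ! j"
      using ij assms omit_omit[of j i xs] omit_omit[of i "Suc j" xs]
      by (auto simp: h_def nth_omit)
    with par[OF ij] show ?case
      by (simp add: p case_prod_unfold)
  qed (auto simp: h_def split: if_splits)
qed

section \<open>Alternating maps\<close>

lemma alternating_multilinearD_add:
  assumes "alternating_multilinear k s s' f" "length (as @ x # bs) = k"
  shows "f (as @ (x + y) # bs) = f (as @ x # bs) + f (as @ y # bs)"
proof -
  have "f ((as @ x # bs)[length as := x + y]) =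
      f ((as @ x # bs)[length as := x]) + f ((as @ x # bs)[length as := y])"
    using assms unfolding alternating_multilinear_def by (auto simp del: list_update_length)
  then show ?thesis by simp
qed

lemma alternating_multilinearD_eq:
  assumes "alternating_multilinear k s s' f" "length (as @ x # x # bs) = k"
  shows "f (as @ x # x # bs) = 0"
proof -
  have "length as < Suc (length as)" "Suc (length as) < k"
    "(as @ x # x # bs) ! length as = (as @ x # x # bs) ! Suc (length as)"
    using assms(2) by (auto simp: nth_append)
  with assms show ?thesis unfolding alternating_multilinear_def by blast
qed

text \<open>Expanding the vanishing value with \<open>x + y\<close> in both adjacent slots leaves
  only the two mixed terms.\<close>

lemma alternating_multilinear_swap:
  assumes "alternating_multilinear k s s' f" "length (as @ x # y # bs) = k"
  shows "f (as @ y # x # bs) = - f (as @ x # y # bs)"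
proof -
  note add = alternating_multilinearD_add[OF assms(1)]
    and eq = alternating_multilinearD_eq[OF assms(1)]
  have "0 = f (as @ (x + y) # (x + y) # bs)"
    using eq[of as "x + y" bs] assms(2) by simp
  also have "\<dots> = f (as @ x # (x + y) # bs) + f (as @ y # (x + y) # bs)"
    using add[of as x "(x + y) # bs" y] assms(2) by simp
  also have "\<dots> = f (as @ x # y # bs) + f (as @ y # x # bs)"
    using add[of "as @ [x]" x bs y] add[of "as @ [y]" x bs y] eq[of as x bs] eq[of as y bs] assms(2)
    by simp
  finally show ?thesis by (metis add_eq_0_iff)
qed

text \<open>Adjacent transpositions carry \<open>x\<close> past the entries of \<open>bs\<close> one
  at a time; \<open>as\<close> is generalized to absorb the entries already passed.\<close>

lemma alternating_multilinear_rotate: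
  assumes "alternating_multilinear k s s' f" "length (as @ x # bs) = k"
  shows "f (as @ bs @ [x]) = psign (length bs) (f (as @ x # bs))"
  using assms(2)
proof (induction bs arbitrary: as)
  case (Cons b bs)
  show ?case
    using Cons.IH[of "as @ [b]"] Cons.prems alternating_multilinear_swap[OF assms(1), of as x b bs]
    by (simp add: psign_def)
qed simp

text \<open>Exactly \<open>k - 1 - i\<close> entries follow position \<open>i\<close>. This
  translates the signed sums with an omitted argument into the update form used by
  \<open>dmulti_t\<close>.\<close>

lemma alternating_multilinear_omit_append:
  assumes "alternating_multilinear k s s' f" "length xs = k" "i < k"
  shows "psign (k - 1 - i) (f (omit i xs @ [x])) = f (xs[i := x])"
proof -
  have "f (omit i xs @ [x]) = psign (k - 1 - i) (f (xs[i := x]))"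
    using alternating_multilinear_rotate[OF assms(1), of "take i xs" x "drop (Suc i) xs"] assms(2,3)
    by (simp add: omit_def upd_conv_take_nth_drop)
  then show ?thesis by (simp add: psign_def)
qed

text \<open>Fixing the last argument of the bracket must give a map on the exterior power of degree
  \<open>n - 1\<close>, so that \<open>ad\<close> is well defined.\<close>

lemma alternating_multilinear_append1:
  assumes f: "alternating_multilinear (Suc k) s s' f"
  shows "alternating_multilinear k s s' (\<lambda>xs. f (xs @ [y]))"
proof -
  have *: "xs[i := x] @ [y] = (xs @ [y])[i := x]" "(xs @ [y]) ! i = xs ! i"
    "length (xs @ [y]) = Suc k" "i < Suc k"
    if "length xs = k" "i < k" for xs :: "'b list" and i x
    using that by (auto simp: list_update_append nth_append)
  have add: "f (zs[i := x + z]) = f (zs[i := x]) + f (zs[i := z])"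
    and scale: "f (zs[i := s c x]) = s' c (f (zs[i := x]))"
    if "length zs = Suc k" "i < Suc k" for zs i c x z
    using f that unfolding alternating_multilinear_def by blast+
  have eq: "f zs = 0" if "length zs = Suc k" "i < j" "j < Suc k" "zs ! i = zs ! j" for zs i j
    using f that unfolding alternating_multilinear_def by blast
  show ?thesis
    unfolding alternating_multilinear_def
  proof (intro conjI allI impI, goal_cases)
    case (1 xs i x z)
    then show ?case
      unfolding *(1)[OF 1] by (intro add) auto
  next
    case (2 xs i c x)
    then show ?case
      unfolding *(1)[OF 2] by (intro scale) auto
  next
    case (3 xs i j)
    then show ?case
      by (intro eq[of _ i j]) (auto simp: nth_append)
  qed
qed

section \<open>Quotients by a fibre relation\<close>

text \<open>The classes are the nonempty fibres of \<open>c\<close>. As \<open>c\<close> is constant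
  on each, its image there is a singleton, and \<open>the_elem\<close> reads off the value without
  choosing a representative.\<close>

lemma equiv_fibres:
  assumes "R = {(x, y). x \<in> A \<and> y \<in> A \<and> c x = c y}"
  shows "equiv A R \<and> (\<exists>\<Phi>. bij_betw \<Phi> (A // R) (c ` A) \<and> (\<forall>x\<in>A. \<Phi> (R `` {x}) = c x))"
proof
  show eq: "equiv A R"
    by (rule equivI) (auto simp: assms refl_on_def sym_on_def trans_on_def)
  define \<Phi> where "\<Phi> C = the_elem (c ` C)" for C
  have \<Phi>: "\<Phi> (R `` {x}) = c x" if "x \<in> A" for x
  proof -
    have "c ` (R `` {x}) = {c x}" using that by (auto simp: assms)
    then show ?thesis by (simp add: \<Phi>_def)
  qed
  have "bij_betw \<Phi> (A // R) (c ` A)"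
  proof (rule bij_betw_imageI)
    show "inj_on \<Phi> (A // R)"
    proof (rule inj_onI)
      fix C D assume "C \<in> A // R" "D \<in> A // R" and CD: "\<Phi> C = \<Phi> D"
      then obtain x y where xy: "x \<in> A" "y \<in> A" "C = R `` {x}" "D = R `` {y}"
        by (auto elim!: quotientE)
      with CD have "c x = c y" by (simp add: \<Phi>)
      with xy show "C = D" by (auto simp: assms)
    qed
    have "A // R = (\<lambda>x. R `` {x}) ` A" by (auto simp: quotient_def)
    then show "\<Phi> ` (A // R) = c ` A" by (simp add: image_image \<Phi> cong: image_cong_simp)
  qed
  with \<Phi> show "\<exists>\<Phi>. bij_betw \<Phi> (A // R) (c ` A) \<and> (\<forall>x\<in>A. \<Phi> (R `` {x}) = c x)"
    by blast
qed

section \<open>Infinitesimal deformations and cocycles\<close>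

context n_lie_algebra
begin

sublocale g: vector_space sg
  using fin_dim_g by (auto simp: finite_dimensional_vector_space_def)

lemma br_append_alternating: "alternating_multilinear (n - 1) sg sg (\<lambda>xs. br (xs @ [y]))"
  by (rule alternating_multilinear_append1) (use br_alternating n_ge_2 in simp)

lemma br_linear:
  assumes "length xs = n" "i < n"
  shows "Vector_Spaces.linear sg sg (\<lambda>x. br (xs[i := x]))"
  by unfold_locales
    (use br_alternating assms in \<open>simp_all add: alternating_multilinear_def\<close>)

lemma ad_ext_class: "ad (ext_class (n - 1) sg p) y = free_ext sg (\<lambda>xs. br (xs @ [y])) p"
  unfolding ad_def by (rule g.ext_lift_ext_class[OF br_append_alternating])

text \<open>On a decomposable element this is the fundamental identity. Both sides are linear in
  \<open>X\<close>, so summing over a representative \<open>p\<close> gives the general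
  case.\<close>

lemma ad_derivation:
  assumes "X \<in> ext_power (n - 1) sg" "length ys = n"
  shows "ad X (br ys) = (\<Sum>i<n. br (ys[i := ad X (ys ! i)]))"
proof -
  obtain p where p: "\<forall>xs\<in>Poly_Mapping.keys p. length xs = n - 1" "X = ext_class (n - 1) sg p"
    using assms by (auto simp: ext_power_def)
  have "br (ys[i := ad X (ys ! i)]) =
      (\<Sum>xs\<in>Poly_Mapping.keys p. sg (Poly_Mapping.lookup p xs) (br (ys[i := br (xs @ [ys ! i])])))"
    if "i < n" for i
  proof -
    interpret Vector_Spaces.linear sg sg "\<lambda>x. br (ys[i := x])"
      by (rule br_linear) (use assms that in auto)
    show ?thesis
      unfolding p(2) ad_ext_class free_ext_def by (simp add: sum scale)
  qed
  then have "(\<Sum>i<n. br (ys[i := ad X (ys ! i)])) = (\<Sum>xs\<in>Poly_Mapping.keys p.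
      sg (Poly_Mapping.lookup p xs) (\<Sum>i<n. br (ys[i := br (xs @ [ys ! i])])))"
    by (simp add: g.scale_sum_right) (rule sum.swap)
  also have "\<dots> = ad X (br ys)"
    unfolding p(2) ad_ext_class free_ext_def
    using p(1) assms(2) by (intro sum.cong refl) (simp add: fundamental_identity)
  finally show ?thesis by simp
qed

end

section \<open>Compatibility of the extended representation with the adjoint action\<close>

context n_lie_rep_pair
begin

sublocale v: vector_space sv
  using fin_dim_v by (auto simp: finite_dimensional_vector_space_def)

lemma rho_update_linear:
  assumes "length xs = n - 1" "i < n - 1"
  shows "Vector_Spaces.linear sg sv (\<lambda>x. rho (xs[i := x]) v)"
  by unfold_locales
    (use rho_alternating[of v] assms in \<open>simp_all add: alternating_multilinear_def\<close>)

lemma rho_ext_ext_class: "rho_ext (ext_class (n - 1) sg p) v = free_ext sv (\<lambda>xs. rho xs v) p"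
  unfolding rho_ext_def by (rule v.ext_lift_ext_class[OF rho_alternating])

text \<open>Linearity in \<open>X\<close> reduces this to \<open>rho_commutator\<close>. The
  commutator is written without subtraction to match the coefficient of \<open>t\<close> in
  condition (ii).\<close>

lemma rho_ext_commutator:
  assumes "X \<in> ext_power (n - 1) sg" "length ys = n - 1"
  shows "rho_ext X (rho ys v) =
    (\<Sum>i<n - 1. rho (ys[i := ad X (ys ! i)]) v) + rho ys (rho_ext X v)"
proof -
  obtain p where p: "\<forall>xs\<in>Poly_Mapping.keys p. length xs = n - 1" "X = ext_class (n - 1) sg p"
    using assms by (auto simp: ext_power_def)
  have upd: "rho (ys[i := ad X (ys ! i)]) v = (\<Sum>xs\<in>Poly_Mapping.keys p.
      sv (Poly_Mapping.lookup p xs) (rho (ys[i := br (xs @ [ys ! i])]) v))"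
    if "i < n - 1" for i
  proof -
    interpret Vector_Spaces.linear sg sv "\<lambda>x. rho (ys[i := x]) v"
      by (rule rho_update_linear) (use assms that in auto)
    show ?thesis
      unfolding p(2) ad_ext_class free_ext_def by (simp add: sum scale)
  qed
  interpret r: Vector_Spaces.linear sv sv "rho ys"
    by (rule rho_linear) (use assms in simp)
  have "(\<Sum>i<n - 1. rho (ys[i := ad X (ys ! i)]) v) = (\<Sum>xs\<in>Poly_Mapping.keys p.
      sv (Poly_Mapping.lookup p xs) (\<Sum>i<n - 1. rho (ys[i := br (xs @ [ys ! i])]) v))"
    using upd by (simp add: v.scale_sum_right) (rule sum.swap)
  also have "\<dots> = (\<Sum>xs\<in>Poly_Mapping.keys p.
      sv (Poly_Mapping.lookup p xs) (rho xs (rho ys v) - rho ys (rho xs v)))"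
    using p assms by (intro sum.cong refl) (simp add: rho_commutator)
  also have "\<dots> = rho_ext X (rho ys v) - rho ys (rho_ext X v)"
    unfolding p(2) rho_ext_ext_class free_ext_def
    by (simp add: v.scale_right_diff_distrib sum_subtractf r.sum r.scale)
  finally show ?thesis by simp
qed

end

section \<open>The deformation equation modulo \<open>t^2\<close>\<close>

context relative_rota_baxter
begin

sublocale T: Vector_Spaces.linear sv sg T
  by (rule T_linear)

lemma snd_dmulti_br_deformation:
  assumes "length us = n"
  shows "snd (dmulti br (map (\<lambda>u. dapply T f (dconst u)) us)) =
    (\<Sum>i<n. br ((map T us)[i := f (us ! i)]))"
  using assms by (simp add: dmulti_def dmulti_t_def dapply_def dconst_def comp_def T.zero)

text \<open>The bracket parts of \<open>rho_T\<close> account for the bracket terms with one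
  argument moved through \<open>f\<close>. What remains on each side is a double sum over two
  omitted arguments, and the two double sums agree by \<open>sum_omit_omit_swap\<close>.\<close>

lemma deformation_t_coefficient:
  assumes f: "Vector_Spaces.linear sv sg f" and us: "length us = n"
  shows "snd (dmulti br (map (\<lambda>u. dapply T f (dconst u)) us)) -
      snd (dapply T f (\<Sum>i<n. psign (n - 1 - i)
        (dmulti_act rho (map (\<lambda>u. dapply T f (dconst u)) (omit i us)) (dconst (us ! i))))) =
    - f (br_T us) + (\<Sum>i<n. psign (n - 1 - i) (rho_T (omit i us) (f (us ! i))))"
proof -
  interpret f: Vector_Spaces.linear sv sg f by fact
  \<comment> \<open>Needed because \<open>dapply\<close> also evaluates \<open>rho\<close> at the
    zero \<open>t\<close>-part of \<open>dconst (us ! i)\<close>.\<close>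
  have rho0: "rho (map T (omit i us)) 0 = 0" if "i < n" for i
  proof -
    interpret Vector_Spaces.linear sv sv "rho (map T (omit i us))"
      by (rule rho_linear) (use that us in simp)
    show ?thesis by (rule zero)
  qed
  \<comment> \<open>Of the two omitted vectors, \<open>x\<close> enters through \<open>f\<close> as
    an argument of \<open>rho\<close>, and \<open>y\<close> is the vector acted on.\<close>
  define H where "H zs x y = T (rho (map T zs @ [f x]) y)" for zs x y
  have br: "psign (n - 1 - i) (br (map T (omit i us) @ [f (us ! i)])) =
      br ((map T us)[i := f (us ! i)])" if "i < n" for i
    using alternating_multilinear_omit_append[OF br_alternating, of "map T us" i "f (us ! i)"]
      that us by (simp add: map_omit)
  have "psign (n - 1 - i) (rho_T (omit i us) (f (us ! i))) =
      br ((map T us)[i := f (us ! i)]) -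
      (\<Sum>j<n - 1. psign (n - 1 - i) (psign (n - 1 - j)
        (H (omit j (omit i us)) (us ! i) (omit i us ! j))))" if "i < n" for i
    using br[OF that] by (simp add: rho_T_def psign_diff psign_sum H_def)
  then have lhs: "(\<Sum>i<n. psign (n - 1 - i) (rho_T (omit i us) (f (us ! i)))) =
      (\<Sum>i<n. br ((map T us)[i := f (us ! i)])) -
      (\<Sum>i<n. \<Sum>j<n - 1. psign (n - 1 - i) (psign (n - 1 - j)
        (H (omit j (omit i us)) (us ! i) (omit i us ! j))))"
    by (simp add: sum_subtractf)
  have "T (psign (n - 1 - i) (dmulti_t (\<lambda>xs. rho xs (us ! i))
        (map (\<lambda>u. (T u, f u)) (omit i us)))) =
      (\<Sum>j<n - 1. psign (n - 1 - i) (psign (n - 2 - j)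
        (H (omit j (omit i us)) (omit i us ! j) (us ! i))))" if "i < n" for i
  proof -
    have len: "length (omit i us) = n - 1" using that us by simp
    \<comment> \<open>Here \<open>rho\<close> has only \<open>n - 1\<close> arguments, so
      \<open>n - 2 - j\<close> of them follow position \<open>j\<close>; this is the source of the
      unequal signs in the two double sums.\<close>
    have "rho ((map T (omit i us))[j := f (omit i us ! j)]) (us ! i) =
        psign (n - 2 - j) (rho (map T (omit j (omit i us)) @ [f (omit i us ! j)]) (us ! i))"
      if "j < n - 1" for j
      using alternating_multilinear_omit_append[OF rho_alternating[of "us ! i"],
          of "map T (omit i us)" j "f (omit i us ! j)"] that len
      by (simp add: map_omit[of _ j] numeral_2_eq_2)
    then have "dmulti_t (\<lambda>xs. rho xs (us ! i)) (map (\<lambda>u. (T u, f u)) (omit i us)) =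
        (\<Sum>j<n - 1. psign (n - 2 - j)
          (rho (map T (omit j (omit i us)) @ [f (omit i us ! j)]) (us ! i)))"
      using len by (simp add: dmulti_t_def comp_def)
    then show ?thesis
      by (simp add: linear_psign[OF T_linear] T.sum psign_sum H_def)
  qed
  then have "T (\<Sum>i<n. psign (n - 1 - i) (dmulti_t (\<lambda>xs. rho xs (us ! i))
        (map (\<lambda>u. (T u, f u)) (omit i us)))) =
      (\<Sum>i<n. \<Sum>j<n - 1. psign (n - 1 - i) (psign (n - 2 - j)
        (H (omit j (omit i us)) (omit i us ! j) (us ! i))))"
    by (simp add: T.sum)
  also have "\<dots> = (\<Sum>i<n. \<Sum>j<n - 1. psign (n - 1 - i) (psign (n - 1 - j)
        (H (omit j (omit i us)) (us ! i) (omit i us ! j))))"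
    by (rule sum_omit_omit_swap[OF us, symmetric])
  finally have T: "T (\<Sum>i<n. psign (n - 1 - i) (dmulti_t (\<lambda>xs. rho xs (us ! i))
        (map (\<lambda>u. (T u, f u)) (omit i us)))) = \<dots>" .
  have "snd (dapply T f (\<Sum>i<n. psign (n - 1 - i)
        (dmulti_act rho (map (\<lambda>u. dapply T f (dconst u)) (omit i us)) (dconst (us ! i))))) =
      f (br_T us) + T (\<Sum>i<n. psign (n - 1 - i) (dmulti_t (\<lambda>xs. rho xs (us ! i))
        (map (\<lambda>u. (T u, f u)) (omit i us))))"
    by (simp add: dapply_def fst_sum snd_sum fst_psign snd_psign dmulti_act_def dconst_def
        comp_def T.zero rho0 br_T_def)
  then show ?thesis
    unfolding snd_dmulti_br_deformation[OF us] lhs T by simp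
qed

text \<open>At \<open>t = 0\<close> the deformation equation is the Rota-Baxter identity of
  \<open>T\<close>, whatever \<open>f\<close> is.\<close>

lemma deformation_constant_coefficient:
  assumes "length us = n"
  shows "fst (dmulti br (map (\<lambda>u. dapply T f (dconst u)) us)) =
      fst (dapply T f (\<Sum>i<n. psign (n - 1 - i)
        (dmulti_act rho (map (\<lambda>u. dapply T f (dconst u)) (omit i us)) (dconst (us ! i)))))"
  using rota_baxter[OF assms]
  by (simp add: dmulti_def dapply_def dconst_def comp_def dmulti_act_def fst_sum fst_psign
      T.sum linear_psign[OF T_linear])

text \<open>The separate term \<open>rho_T us (f v)\<close> is the summand at
  \<open>i = n - 1\<close>, with sign exponent 0, so all \<open>n\<close> arguments can be treated
  alike.\<close>

lemma d1_eq:
  assumes "length us = n - 1"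
  shows "d1 f us v = - f (br_T (us @ [v])) +
    (\<Sum>i<n. psign (n - 1 - i) (rho_T (omit i (us @ [v])) (f ((us @ [v]) ! i))))"
proof -
  have "(\<Sum>i<n. psign (n - 1 - i) (rho_T (omit i (us @ [v])) (f ((us @ [v]) ! i)))) =
      (\<Sum>i<Suc (n - 1). psign (n - 1 - i) (rho_T (omit i (us @ [v])) (f ((us @ [v]) ! i))))"
    using n_ge_2 by simp
  also have "\<dots> = rho_T us (f v) +
      (\<Sum>i<n - 1. psign (n - 1 - i) (rho_T (omit i us @ [v]) (f (us ! i))))"
    using assms omit_length_append[of us v]
    by (simp del: omit_length_append add: omit_append_less nth_append)
  finally show ?thesis by (simp add: d1_def)
qed

lemma infinitesimal_deformations_eq_Z1: "infinitesimal_deformations = Z1"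
proof -
  let ?D = "\<lambda>f us. dmulti br (map (\<lambda>u. dapply T f (dconst u)) us) =
    dapply T f (\<Sum>i<n. psign (n - 1 - i)
      (dmulti_act rho (map (\<lambda>u. dapply T f (dconst u)) (omit i us)) (dconst (us ! i))))"
  have eq: "?D f (us @ [v]) \<longleftrightarrow> d1 f us v = 0"
    if "Vector_Spaces.linear sv sg f" "length us = n - 1" for f us v
  proof -
    have len: "length (us @ [v]) = n" using that n_ge_2 by simp
    show ?thesis
      unfolding d1_eq[OF that(2)] deformation_t_coefficient[OF that(1) len, symmetric]
      using deformation_constant_coefficient[OF len, of f] by (simp add: prod_eq_iff)
  qed
  \<comment> \<open>Since \<open>n\<close> is positive, quantifying over \<open>n\<close> arguments
    is the same as quantifying over the \<open>n - 1\<close> arguments and the last one that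
    \<open>d1\<close> takes separately.\<close>
  have split: "(\<forall>us. length us = n \<longrightarrow> P us) \<longleftrightarrow> (\<forall>us v. length us = n - 1 \<longrightarrow> P (us @ [v]))"
    for P :: "'v list \<Rightarrow> bool"
  proof (intro iffI allI impI)
    fix us :: "'v list"
    assume *: "\<forall>us v. length us = n - 1 \<longrightarrow> P (us @ [v])" and us: "length us = n"
    then have "P (butlast us @ [last us])" by simp
    moreover have "us \<noteq> []" using us n_ge_2 by auto
    ultimately show "P us" by simp
  next
    fix us :: "'v list" and v
    assume "\<forall>us. length us = n \<longrightarrow> P us" and us: "length us = n - 1"
    moreover have "length (us @ [v]) = n" using us n_ge_2 by simp
    ultimately show "P (us @ [v])" by blast
  qed
  show ?thesis
    unfolding infinitesimal_deformations_def Z1_def Let_def split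
    using eq by (intro Collect_cong) blast
qed

section \<open>Equivalence and coboundaries\<close>

lemma deformations_equivalent_iff:
  "deformations_equivalent f g \<longleftrightarrow> (\<lambda>v. g v - f v) \<in> B1"
proof -
  have i: "dmulti br (map (\<lambda>x. dapply id (ad X) (dconst x)) xs) = dapply id (ad X) (dconst (br xs))"
    if "X \<in> C0" "length xs = n" for X xs
    using ad_derivation[OF that] that(2)
    by (simp add: dmulti_def dmulti_t_def dapply_def dconst_def comp_def)
  have ii: "dapply id (rho_ext X) (dconst (rho xs u)) =
      dmulti_act rho (map (\<lambda>x. dapply id (ad X) (dconst x)) xs) (dapply id (rho_ext X) (dconst u))"
    if "X \<in> C0" "length xs = n - 1" for X xs u
    using rho_ext_commutator[OF that] that(2)
    by (simp add: dmulti_act_def dmulti_t_def dapply_def dconst_def comp_def)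
  \<comment> \<open>The coefficient of \<open>t\<close> at \<open>(v, w)\<close> compares
    \<open>f v + T (rho_ext X v)\<close> with \<open>ad X (T v) + g v\<close>; the summand
    \<open>T w\<close> occurs on both sides and cancels.\<close>
  have iii: "dapply T f \<circ> dapply id (rho_ext X) = dapply id (ad X) \<circ> dapply T g \<longleftrightarrow>
      (\<lambda>v. g v - f v) = d0 X" for X
  proof -
    have "(dapply T f \<circ> dapply id (rho_ext X)) (v, w) = (dapply id (ad X) \<circ> dapply T g) (v, w)
        \<longleftrightarrow> g v - f v = d0 X v" for v w
      by (auto simp: dapply_def d0_def T.add algebra_simps)
    then show ?thesis by (auto simp: fun_eq_iff)
  qed
  show ?thesis
    unfolding deformations_equivalent_def Let_def B1_def image_iff
    using i ii iii by (intro bex_cong) auto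
qed

section \<open>The subgroup of coboundaries and its cosets\<close>

lemma d0_ext_class: "d0 (ext_class (n - 1) sg p) v =
    T (free_ext sv (\<lambda>xs. rho xs v) p) - free_ext sg (\<lambda>xs. br (xs @ [T v])) p"
  unfolding d0_def rho_ext_ext_class ad_ext_class ..

text \<open>By \<open>d0_ext_class\<close>, \<open>d0\<close> depends linearly on the
  representative, so \<open>p - q\<close> is a witness and no vector space structure on the cosets
  is required.\<close>

lemma B1_diff:
  assumes "b \<in> B1" "c \<in> B1"
  shows "(\<lambda>v. b v - c v) \<in> B1"
proof -
  obtain p q where p: "\<forall>xs\<in>Poly_Mapping.keys p. length xs = n - 1" "b = d0 (ext_class (n - 1) sg p)"
    and q: "\<forall>xs\<in>Poly_Mapping.keys q. length xs = n - 1" "c = d0 (ext_class (n - 1) sg q)"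
    using assms by (auto simp: B1_def ext_power_def)
  have "(\<lambda>v. b v - c v) = d0 (ext_class (n - 1) sg (p - q))"
  proof
    fix v
    interpret F: Vector_Spaces.linear free_scale sv "free_ext sv (\<lambda>xs. rho xs v)"
      by (rule v.free_ext_linear)
    interpret G: Vector_Spaces.linear free_scale sg "free_ext sg (\<lambda>xs. br (xs @ [T v]))"
      by (rule g.free_ext_linear)
    show "b v - c v = d0 (ext_class (n - 1) sg (p - q)) v"
      unfolding p(2) q(2) d0_ext_class F.diff G.diff T.diff by simp
  qed
  moreover have "\<forall>xs\<in>Poly_Mapping.keys (p - q). length xs = n - 1"
    using p q keys_diff[of p q] by auto
  ultimately show ?thesis by (auto simp: B1_def ext_power_def)
qed

lemma zero_in_B1: "(\<lambda>v. 0) \<in> B1"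
proof -
  have "ext_class (n - 1) sg 0 \<in> C0" by (auto simp: ext_power_def)
  then have "d0 (ext_class (n - 1) sg 0) \<in> B1" by (simp add: B1_def)
  \<comment> \<open>The coboundary just found is subtracted from itself.\<close>
  then show ?thesis using B1_diff by fastforce
qed

lemma cohomology_class_eq_iff:
  "cohomology_class f = cohomology_class g \<longleftrightarrow> (\<lambda>v. g v - f v) \<in> B1"
proof
  assume eq: "cohomology_class f = cohomology_class g"
  have "g \<in> cohomology_class g"
    unfolding cohomology_class_def using zero_in_B1 by force
  then obtain b where "b \<in> B1" "g = (\<lambda>v. f v + b v)"
    using eq by (auto simp: cohomology_class_def)
  then show "(\<lambda>v. g v - f v) \<in> B1" by simp
next
  assume gf: "(\<lambda>v. g v - f v) \<in> B1"
  \<comment> \<open>One inclusion is proved for arbitrary \<open>f\<close> and \<open>g\<close>; the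
    reverse one follows because \<open>B1\<close> is closed under negation.\<close>
  have sub: "cohomology_class f \<subseteq> cohomology_class g"
    if "(\<lambda>v. g v - f v) \<in> B1" for f g
  proof
    fix h assume "h \<in> cohomology_class f"
    then obtain b where b: "b \<in> B1" "h = (\<lambda>v. f v + b v)"
      by (auto simp: cohomology_class_def)
    from B1_diff[OF b(1) that] have "(\<lambda>v. b v - (g v - f v)) \<in> B1" .
    moreover have "h = (\<lambda>v. g v + (b v - (g v - f v)))" by (simp add: b add.commute)
    ultimately show "h \<in> cohomology_class g"
      unfolding cohomology_class_def by (intro CollectI exI conjI)
  qed
  have "(\<lambda>v. f v - g v) \<in> B1" using B1_diff[OF zero_in_B1 gf] by simp
  with gf show "cohomology_class f = cohomology_class g" by (intro equalityI sub)
qed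

text \<open>Equivalence and equality of cosets both amount to \<open>g - f\<close> being a
  coboundary. The relation thus has the fibre form that \<open>equiv_fibres\<close> expects.\<close>

lemma deformation_rel_eq:
  "deformation_rel = {(f, g). f \<in> infinitesimal_deformations \<and> g \<in> infinitesimal_deformations \<and>
     cohomology_class f = cohomology_class g}"
  by (simp add: deformation_rel_def deformations_equivalent_iff cohomology_class_eq_iff)

end

theorem theorem5p3:
  fixes n :: nat
    and sg :: "'k::{alg_closed_field, field_char_0} \<Rightarrow> 'g::ab_group_add \<Rightarrow> 'g"
    and br :: "'g list \<Rightarrow> 'g"
    and sv :: "'k \<Rightarrow> 'v::ab_group_add \<Rightarrow> 'v"
    and rho :: "'g list \<Rightarrow> 'v \<Rightarrow> 'v"
    and T :: "'v \<Rightarrow> 'g"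
  assumes "relative_rota_baxter n sg br sv rho T"
  shows "let Def = relative_rota_baxter.infinitesimal_deformations n sg br sv rho T;
             R = relative_rota_baxter.deformation_rel n sg br sv rho T;
             H = relative_rota_baxter.H1 n sg br sv rho T;
             cls = relative_rota_baxter.cohomology_class n sg br sv rho T
         in equiv Def R \<and>
            (\<exists>\<Phi>. bij_betw \<Phi> (Def // R) H \<and> (\<forall>T1\<in>Def. \<Phi> (R `` {T1}) = cls T1))"
proof -
  interpret relative_rota_baxter n sg br sv rho T by fact
  show ?thesis
    \<comment> \<open>The bijection lands in the image of the deformations under
      \<open>cohomology_class\<close>; this is \<open>H1\<close>, because the deformations are
      exactly the elements of \<open>Z1\<close>.\<close>
    using equiv_fibres[OF deformation_rel_eq]
    by (simp add: Let_def H1_def infinitesimal_deformations_eq_Z1)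
qed

end
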